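(* Let $\mathbb{K}$ be $\mathbb{R}$ or $\mathbb{C}$. Every topological exponential vector space over $\mathbb{K}$ is radial.
   Context: An exponential vector space (evs) over a field $K$ is a partially ordered set $(X,\leq)$ with a binary operation $+$ on $X$ and a scalar multiplication $\cdot:K\times X\to X$ such that for all $x,y,z\in X$, $\alpha,\beta\in K$: ($A_1$) $(X,+)$ is a commutative semigroup with identity $\theta$; ($A_2$) $x\leq y$ implies $x+z\leq y+z$ and $\alpha\cdot x\leq\alpha\cdot y$; ($A_3$) $\alpha\cdot(x+y)=\alpha\cdot x+\alpha\cdot y$, $\alpha\cdot(\beta\cdot x)=(\alpha\beta)\cdot x$, $(\alpha+\beta)\cdot x\leq\alpha\cdot x+\beta\cdot x$, $1\cdot x=x$; ($A_4$) $\alpha\cdot x=\theta$ iff $\alpha=0$ or $x=\theta$; ($A_5$) $x+(-1)\cdot x=\theta$ iff $x\in X_0:=\{z\in X: y\nleq z\ \forall y\in X\smallsetminus\{z\}\}$ (the set of minimal elements); ($A_6$) for each $x\in X$ there is $p\in X_0$ with $p\leq x$. A topological evs over $\mathbb{K}$ ($=\mathbb{R}$ or $\mathbb{C}$, usual topology) is an evs $X$ over $\mathbb{K}$ with a topology such that addition $X\times X\to X$ and scalar multiplication $\mathbb{K}\times X\to X$ are continuous and the partial order is closed, i.e. $\{(x,y)\in X\times X:x\leq y\}$ is closed in $X\times X$. A set $A\subseteq X$ is absorbing if for every $x\in X$ there is a real $\alpha>0$ such that $\mu x\in A$ for all $\mu\in\mathbb{K}$ with $|\mu|\leq\alpha$.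 An evs $X$ over $\mathbb{K}$ is radial if for any $x,y\in X$ with $x\neq y$ there is an absorbing set which contains one of $x$ and $y$ but not both. *)

theory Defs
  imports "HOL-Analysis.Analysis"
begin

definition minimal_elements :: "'a set \<Rightarrow> ('a \<Rightarrow> 'a \<Rightarrow> bool) \<Rightarrow> 'a set" where
  "minimal_elements X le = {z \<in> X. \<forall>y \<in> X - {z}. \<not> le y z}"

locale evs =
  fixes X :: "'a set"
    and le :: "'a \<Rightarrow> 'a \<Rightarrow> bool" (infix "\<preceq>" 50)
    and add :: "'a \<Rightarrow> 'a \<Rightarrow> 'a" (infixl "\<oplus>" 65)
    and smul :: "'k::field \<Rightarrow> 'a \<Rightarrow> 'a" (infixr "\<odot>" 75)
    and \<theta> :: 'a
  assumes leq_refl: "reflp_on X (\<preceq>)"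
    and leq_antisym: "antisymp_on X (\<preceq>)"
    and leq_trans: "transp_on X (\<preceq>)"
    and add_closed: "\<lbrakk>x \<in> X; y \<in> X\<rbrakk> \<Longrightarrow> x \<oplus> y \<in> X"
    and smul_closed: "x \<in> X \<Longrightarrow> \<alpha> \<odot> x \<in> X"
    and theta_closed: "\<theta> \<in> X"
    and add_assoc: "\<lbrakk>x \<in> X; y \<in> X; z \<in> X\<rbrakk> \<Longrightarrow> (x \<oplus> y) \<oplus> z = x \<oplus> (y \<oplus> z)"
    and add_commute: "\<lbrakk>x \<in> X; y \<in> X\<rbrakk> \<Longrightarrow> x \<oplus> y = y \<oplus> x"
    and add_theta: "x \<in> X \<Longrightarrow> x \<oplus> \<theta> = x"
    and add_mono: "\<lbrakk>x \<in> X; y \<in> X; z \<in> X; x \<preceq> y\<rbrakk> \<Longrightarrow> x \<oplus> z \<preceq> y \<oplus> z"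
    and smul_mono: "\<lbrakk>x \<in> X; y \<in> X; x \<preceq> y\<rbrakk> \<Longrightarrow> \<alpha> \<odot> x \<preceq> \<alpha> \<odot> y"
    and smul_add_right: "\<lbrakk>x \<in> X; y \<in> X\<rbrakk> \<Longrightarrow> \<alpha> \<odot> (x \<oplus> y) = \<alpha> \<odot> x \<oplus> \<alpha> \<odot> y"
    and smul_smul: "x \<in> X \<Longrightarrow> \<alpha> \<odot> \<beta> \<odot> x = (\<alpha> * \<beta>) \<odot> x"
    and smul_add_left: "x \<in> X \<Longrightarrow> (\<alpha> + \<beta>) \<odot> x \<preceq> \<alpha> \<odot> x \<oplus> \<beta> \<odot> x"
    and smul_one: "x \<in> X \<Longrightarrow> 1 \<odot> x = x"
    and smul_eq_theta_iff: "x \<in> X \<Longrightarrow> \<alpha> \<odot> x = \<theta> \<longleftrightarrow> \<alpha> = 0 \<or> x = \<theta>"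
    and add_neg_eq_theta_iff:
      "x \<in> X \<Longrightarrow> x \<oplus> (- 1) \<odot> x = \<theta> \<longleftrightarrow> x \<in> minimal_elements X (\<preceq>)"
    and minimal_below: "x \<in> X \<Longrightarrow> \<exists>p \<in> minimal_elements X (\<preceq>). p \<preceq> x"

locale topological_evs = evs X le add smul \<theta>
  for X :: "'a set"
    and le :: "'a \<Rightarrow> 'a \<Rightarrow> bool" (infix "\<preceq>" 50)
    and add :: "'a \<Rightarrow> 'a \<Rightarrow> 'a" (infixl "\<oplus>" 65)
    and smul :: "'k::real_normed_field \<Rightarrow> 'a \<Rightarrow> 'a" (infixr "\<odot>" 75)
    and \<theta> :: 'a +
  fixes T :: "'a topology"
  assumes topspace_eq: "topspace T = X"
    and continuous_add: "continuous_map (prod_topology T T) T (\<lambda>(x, y). x \<oplus> y)"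
    and continuous_smul: "continuous_map (prod_topology euclidean T) T (\<lambda>(\<alpha>, x). \<alpha> \<odot> x)"
    and closed_order: "closedin (prod_topology T T) {(x, y) \<in> X \<times> X. x \<preceq> y}"

definition absorbing ::
    "'a set \<Rightarrow> ('k::real_normed_field \<Rightarrow> 'a \<Rightarrow> 'a) \<Rightarrow> 'a set \<Rightarrow> bool" where
  "absorbing X smul A \<longleftrightarrow>
     A \<subseteq> X \<and> (\<forall>x \<in> X. \<exists>\<alpha>::real. \<alpha> > 0 \<and> (\<forall>\<mu>. norm \<mu> \<le> \<alpha> \<longrightarrow> smul \<mu> x \<in> A))"

definition radial :: "'a set \<Rightarrow> ('k::real_normed_field \<Rightarrow> 'a \<Rightarrow> 'a) \<Rightarrow> bool" where
  "radial X smul \<longleftrightarrow>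
     (\<forall>x \<in> X. \<forall>y \<in> X. x \<noteq> y \<longrightarrow>
       (\<exists>A. absorbing X smul A \<and> (x \<in> A \<and> y \<notin> A \<or> y \<in> A \<and> x \<notin> A)))"

end

theory Submission
  imports Defs
begin

text \<open>
  Nothing in the definition of an absorbing set bounds it from above: it need only contain the small multiples of
  every point, so the separating set can be taken as large as possible: the complement of a
  single point \<open>y \<noteq> \<theta>\<close>. Of two distinct points at least one is different from \<open>\<theta>\<close>, and the
  complement of that one contains the other.

  That such a complement is absorbing comes from the topology. The order is closed and antisymmetric,
  so points are closed; hence \<open>X - {y}\<close> is an open neighbourhood of \<open>\<theta>\<close>. For fixed \<open>z\<close> the map
  \<open>\<mu> \<mapsto> \<mu> \<odot> z\<close> is continuous and sends \<open>0\<close> to \<open>\<theta>\<close>, so it sends a small disc around \<open>0\<close> into that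
  neighbourhood. The argument works over every real normed field.
\<close>

context topological_evs
begin

text \<open>By reflexivity and antisymmetry \<open>{y}\<close> is the intersection of the lower and the upper set of
  \<open>y\<close>, both of which are sections of the closed order relation.\<close>

lemma closedin_singleton:
  assumes y: "y \<in> X"
  shows "closedin T {y}"
proof -
  let ?R = "{(u, v) \<in> X \<times> X. u \<preceq> v}"
  have below: "continuous_map T (prod_topology T T) (\<lambda>z. (z, y))"
    and above: "continuous_map T (prod_topology T T) (\<lambda>z. (y, z))"
    using y by (simp_all add: continuous_map_pairedI topspace_eq)
  have "closedin T ({z \<in> topspace T. (z, y) \<in> ?R} \<inter> {z \<in> topspace T. (y, z) \<in> ?R})"
    by (intro closedin_Int closedin_continuous_map_preimage[OF below]
        closedin_continuous_map_preimage[OF above] closed_order)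
  also have "{z \<in> topspace T. (z, y) \<in> ?R} \<inter> {z \<in> topspace T. (y, z) \<in> ?R} = {y}"
    using y leq_refl leq_antisym by (auto simp: topspace_eq reflp_on_def antisymp_on_def)
  finally show ?thesis .
qed

lemma continuous_map_smul_left:
  assumes z: "z \<in> X"
  shows "continuous_map euclidean T (\<lambda>\<mu>. \<mu> \<odot> z)"
proof -
  have "continuous_map euclidean (prod_topology euclidean T) (\<lambda>\<mu>. (\<mu>, z))"
    using z by (simp add: continuous_map_pairedI topspace_eq)
  from continuous_map_compose[OF this continuous_smul] show ?thesis
    by (simp add: o_def)
qed

lemma absorbing_open_neighbourhood:
  assumes U: "openin T U" and theta: "\<theta> \<in> U"
  shows "absorbing X smul U"
  unfolding absorbing_def
proof (intro conjI ballI)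
  show "U \<subseteq> X"
    using openin_subset[OF U] by (simp add: topspace_eq)
next
  fix z assume z: "z \<in> X"
  have "open {\<mu>. \<mu> \<odot> z \<in> U}"
    using openin_continuous_map_preimage[OF continuous_map_smul_left[OF z] U] by simp
  moreover have "0 \<odot> z = \<theta>"
    using smul_eq_theta_iff[OF z] by simp
  ultimately obtain \<alpha> where "\<alpha> > 0" and "cball 0 \<alpha> \<subseteq> {\<mu>. \<mu> \<odot> z \<in> U}"
    using theta by (auto simp: open_contains_cball)
  then show "\<exists>\<alpha>>0. \<forall>\<mu>. norm \<mu> \<le> \<alpha> \<longrightarrow> \<mu> \<odot> z \<in> U"
    by (auto simp: subset_iff)
qed

lemma absorbing_complement_singleton:
  assumes "y \<in> X" and "y \<noteq> \<theta>"
  shows "absorbing X smul (X - {y})"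
proof (rule absorbing_open_neighbourhood)
  show "openin T (X - {y})"
    using closedin_singleton[OF \<open>y \<in> X\<close>] by (simp add: closedin_def topspace_eq)
  show "\<theta> \<in> X - {y}"
    using \<open>y \<noteq> \<theta>\<close> theta_closed by simp
qed

lemma radial: "radial X smul"
  unfolding radial_def
proof (intro ballI impI)
  fix x y assume xy: "x \<in> X" "y \<in> X" "x \<noteq> y"
  then consider "x \<noteq> \<theta>" | "y \<noteq> \<theta>" by blast
  then show "\<exists>A. absorbing X smul A \<and> (x \<in> A \<and> y \<notin> A \<or> y \<in> A \<and> x \<notin> A)"
    using xy absorbing_complement_singleton by cases blast+
qed

end

theorem mainTheorem6:
  "(\<forall>(X :: 'a set) le add (smul :: real \<Rightarrow> 'a \<Rightarrow> 'a) \<theta> T.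
      topological_evs X le add smul \<theta> T \<longrightarrow> radial X smul) \<and>
   (\<forall>(X :: 'a set) le add (smul :: complex \<Rightarrow> 'a \<Rightarrow> 'a) \<theta> T.
      topological_evs X le add smul \<theta> T \<longrightarrow> radial X smul)"
  by (blast intro: topological_evs.radial)

end
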